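(* Let $(D,\le)$ be a directed set and $(X,\Phi)$ be a uniform space. Let $\mathcal{I}$, $\mathcal{K}$ be $D$-admissible ideals on $D$ such that $\mathcal{K}\subseteq\mathcal{I}$. Suppose that every $\mathcal{I}^{\mathcal{K}}$-Cauchy net $x\colon D\to X$ is $\mathcal{I}^{\mathcal{K}}$-convergent (to some point of $X$). Then every Cauchy net $x\colon D\to X$ on the directed set $D$ is convergent.
   Context: An ideal on a set $S$ is a nonempty family of subsets of $S$ closed under subsets and finite unions; it is proper if it does not contain $S$. Its dual filter is $\mathcal{F}(\mathcal{I})=\{S\setminus A: A\in\mathcal{I}\}$. For $M\subseteq S$, $\mathcal{K}|_M=\{A\cap M: A\in\mathcal{K}\}$ is the trace ideal on $M$. For a directed set $(D,\le)$, $\mathcal{F}_D$ is the filter on $D$ generated by the sets $\{x\in D: x\ge d\}$, $d\in D$, and $\mathcal{I}_D$ is its dual ideal. An ideal $\mathcal{I}$ on $D$ is $D$-admissible if it is proper and $\mathcal{I}_D\subseteq\mathcal{I}$. Uniform spaces $(X,\Phi)$ are assumed Hausdorff ($\bigcap\Phi$ is the diagonal) and entourages $U\in\Phi$ are taken symmetric. A net $(x_d)_{d\in D}$ is Cauchy if for every $U\in\Phi$ there is $d_0\in D$ with $(x_d,x_e)\in U$ for all $d,e\ge d_0$. A map $f\colon S\to X$ is $\mathcal{I}$-Cauchy if for every $U\in\Phi$ there exists $m\in S$ such that $\{n\in S: (f(n),f(m))\notin U\}\in\mathcal{I}$. It is $\mathcal{I}^{\mathcal{K}}$-Cauchy if there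 is $M\in\mathcal{F}(\mathcal{I})$ such that $f|_M\colon M\to X$ is $\mathcal{K}|_M$-Cauchy. It is $\mathcal{I}$-convergent to $x\in X$ if $f^{-1}(U)\in\mathcal{F}(\mathcal{I})$ for each neighborhood $U$ of $x$. It is $\mathcal{I}^{\mathcal{K}}$-convergent to $x$ if there is $M\in\mathcal{F}(\mathcal{I})$ such that $f|_M$ is $\mathcal{K}|_M$-convergent to $x$. *)

theory Defs
  imports "HOL-Analysis.Analysis"
begin

text \<open>
  Maps defined on a subset \<open>S\<close> of a type are total functions; every notion below takes the
  domain \<open>S\<close> as an argument and depends only on the values on \<open>S\<close>. In particular the
  restriction to \<open>M \<subseteq> S\<close> is expressed by passing \<open>M\<close> as the domain.
\<close>

section \<open>Ideals\<close>

definition ideal_on :: "'s set \<Rightarrow> 's set set \<Rightarrow> bool" where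
  "ideal_on S I \<longleftrightarrow> I \<subseteq> Pow S \<and> I \<noteq> {} \<and>
     (\<forall>A\<in>I. \<forall>B. B \<subseteq> A \<longrightarrow> B \<in> I) \<and> (\<forall>A\<in>I. \<forall>B\<in>I. A \<union> B \<in> I)"

definition proper_ideal_on :: "'s set \<Rightarrow> 's set set \<Rightarrow> bool" where
  "proper_ideal_on S I \<longleftrightarrow> ideal_on S I \<and> S \<notin> I"

text \<open>Sends an ideal on \<open>S\<close> to its dual filter and a filter on \<open>S\<close> to its dual ideal.\<close>

definition dual_on :: "'s set \<Rightarrow> 's set set \<Rightarrow> 's set set" where
  "dual_on S I = {S - A |A. A \<in> I}"

definition trace_on :: "'s set \<Rightarrow> 's set set \<Rightarrow> 's set set" where
  "trace_on M K = {A \<inter> M |A. A \<in> K}"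

section \<open>Directed sets\<close>

definition directed_set :: "'d set \<Rightarrow> ('d \<Rightarrow> 'd \<Rightarrow> bool) \<Rightarrow> bool" where
  "directed_set D le \<longleftrightarrow> D \<noteq> {} \<and> reflp_on D le \<and> transp_on D le \<and>
     (\<forall>a\<in>D. \<forall>b\<in>D. \<exists>c\<in>D. le a c \<and> le b c)"

definition generated_filter_on :: "'s set \<Rightarrow> 's set set \<Rightarrow> 's set set" where
  "generated_filter_on S G = {A. A \<subseteq> S \<and> (\<exists>F. finite F \<and> F \<subseteq> G \<and> S \<inter> \<Inter>F \<subseteq> A)}"

definition tail_filter :: "'d set \<Rightarrow> ('d \<Rightarrow> 'd \<Rightarrow> bool) \<Rightarrow> 'd set set" where
  "tail_filter D le = generated_filter_on D {{x \<in> D. le d x} |d. d \<in> D}"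

definition tail_ideal :: "'d set \<Rightarrow> ('d \<Rightarrow> 'd \<Rightarrow> bool) \<Rightarrow> 'd set set" where
  "tail_ideal D le = dual_on D (tail_filter D le)"

definition admissible_ideal :: "'d set \<Rightarrow> ('d \<Rightarrow> 'd \<Rightarrow> bool) \<Rightarrow> 'd set set \<Rightarrow> bool" where
  "admissible_ideal D le I \<longleftrightarrow> proper_ideal_on D I \<and> tail_ideal D le \<subseteq> I"

section \<open>Uniform spaces\<close>

text \<open>Entourages are taken symmetric; the symmetric ones form a base of the uniformity.\<close>

definition entourages :: "('x::uniform_space \<times> 'x) set set" where
  "entourages = {U. eventually (\<lambda>p. p \<in> U) uniformity \<and> sym U}"

definition hausdorff_uniformity :: "'x::uniform_space itself \<Rightarrow> bool" where
  "hausdorff_uniformity _ \<longleftrightarrow> \<Inter>(entourages :: ('x \<times> 'x) set set) = Id"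

definition neighborhoods :: "'x::topological_space \<Rightarrow> 'x set set" where
  "neighborhoods l = {U. eventually (\<lambda>y. y \<in> U) (nhds l)}"

section \<open>Cauchy and convergent maps and nets\<close>

definition ideal_Cauchy :: "'s set \<Rightarrow> 's set set \<Rightarrow> ('s \<Rightarrow> 'x::uniform_space) \<Rightarrow> bool" where
  "ideal_Cauchy S I f \<longleftrightarrow> (\<forall>U\<in>entourages. \<exists>m\<in>S. {n \<in> S. (f n, f m) \<notin> U} \<in> I)"

definition ideal_converges ::
    "'s set \<Rightarrow> 's set set \<Rightarrow> ('s \<Rightarrow> 'x::uniform_space) \<Rightarrow> 'x \<Rightarrow> bool" where
  "ideal_converges S I f l \<longleftrightarrow> (\<forall>U\<in>neighborhoods l. {n \<in> S. f n \<in> U} \<in> dual_on S I)"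

definition IK_Cauchy ::
    "'s set \<Rightarrow> 's set set \<Rightarrow> 's set set \<Rightarrow> ('s \<Rightarrow> 'x::uniform_space) \<Rightarrow> bool" where
  "IK_Cauchy S I K f \<longleftrightarrow> (\<exists>M\<in>dual_on S I. ideal_Cauchy M (trace_on M K) f)"

definition IK_converges ::
    "'s set \<Rightarrow> 's set set \<Rightarrow> 's set set \<Rightarrow> ('s \<Rightarrow> 'x::uniform_space) \<Rightarrow> 'x \<Rightarrow> bool" where
  "IK_converges S I K f l \<longleftrightarrow> (\<exists>M\<in>dual_on S I. ideal_converges M (trace_on M K) f l)"

definition Cauchy_net ::
    "'d set \<Rightarrow> ('d \<Rightarrow> 'd \<Rightarrow> bool) \<Rightarrow> ('d \<Rightarrow> 'x::uniform_space) \<Rightarrow> bool" where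
  "Cauchy_net D le x \<longleftrightarrow>
     (\<forall>U\<in>entourages. \<exists>d0\<in>D. \<forall>d\<in>D. \<forall>e\<in>D. le d0 d \<longrightarrow> le d0 e \<longrightarrow> (x d, x e) \<in> U)"

definition net_converges ::
    "'d set \<Rightarrow> ('d \<Rightarrow> 'd \<Rightarrow> bool) \<Rightarrow> ('d \<Rightarrow> 'x::topological_space) \<Rightarrow> 'x \<Rightarrow> bool" where
  "net_converges D le x l \<longleftrightarrow>
     (\<forall>U\<in>neighborhoods l. \<exists>d0\<in>D. \<forall>d\<in>D. le d0 d \<longrightarrow> x d \<in> U)"

end

theory Submission
  imports Defs
begin

text \<open>
  An admissible ideal contains the complement of every tail \<open>{n \<in> D. le d n}\<close>. This has two
  consequences. First, a Cauchy net stays within a given entourage of its value at some index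
  \<open>d0\<close>, apart from the complement of a tail, which is a set in \<open>K\<close>; so it is
  \<open>I\<^sup>K\<close>-Cauchy, with \<open>D\<close> itself as the witnessing set of the dual filter
  (lemma \<open>Cauchy_net_imp_IK_Cauchy\<close>), and the hypothesis gives an \<open>I\<^sup>K\<close>-limit \<open>l\<close>.
  Secondly, no tail belongs to a proper admissible ideal. Since \<open>K \<subseteq> I\<close>, the point \<open>l\<close> is an
  \<open>I\<close>-limit, so for each neighborhood of \<open>l\<close> the indices whose values miss it form a set
  in \<open>I\<close>, and this set contains no tail. Hence \<open>l\<close> is a cluster point of the net
  (lemma \<open>ideal_converges_imp_cluster_point\<close>). As in any uniform space, a Cauchy net converges
  to each of its cluster points (lemma \<open>Cauchy_net_converges_to_cluster_point\<close>).
\<close>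

lemma ideal_on_subset: "ideal_on S I \<Longrightarrow> A \<in> I \<Longrightarrow> B \<subseteq> A \<Longrightarrow> B \<in> I"
  by (auto simp: ideal_on_def)

lemma ideal_on_Un: "ideal_on S I \<Longrightarrow> A \<in> I \<Longrightarrow> B \<in> I \<Longrightarrow> A \<union> B \<in> I"
  by (auto simp: ideal_on_def)

lemma carrier_in_dual: "ideal_on S I \<Longrightarrow> S \<in> dual_on S I"
proof -
  assume "ideal_on S I"
  then have "{} \<in> I"
    by (auto simp: ideal_on_def)
  then show ?thesis
    unfolding dual_on_def by force
qed

lemma admissible_ideal_on: "admissible_ideal D le I \<Longrightarrow> ideal_on D I"
  by (simp add: admissible_ideal_def proper_ideal_on_def)

lemma admissible_contains_tail_complement:
  assumes "admissible_ideal D le I" and "d \<in> D"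
  shows "{n \<in> D. \<not> le d n} \<in> I"
proof -
  let ?T = "{n \<in> D. le d n}"
  have "?T \<in> tail_filter D le"
    unfolding tail_filter_def generated_filter_on_def
    using assms(2) by (auto intro!: exI[of _ "{?T}"])
  then have "D - ?T \<in> tail_ideal D le"
    unfolding tail_ideal_def dual_on_def by blast
  moreover have "D - ?T = {n \<in> D. \<not> le d n}"
    by blast
  ultimately show ?thesis
    using assms(1) by (auto simp: admissible_ideal_def)
qed

lemma admissible_set_misses_tail:
  assumes "admissible_ideal D le I" and "A \<in> I" and "d \<in> D"
  shows "\<exists>e\<in>D. le d e \<and> e \<notin> A"
proof (rule ccontr)
  assume "\<not> ?thesis"
  then have "D \<subseteq> A \<union> {n \<in> D. \<not> le d n}"
    by blast
  moreover have "A \<union> {n \<in> D. \<not> le d n} \<in> I"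
    using assms
    by (intro ideal_on_Un[OF admissible_ideal_on] admissible_contains_tail_complement)
  ultimately have "D \<in> I"
    using ideal_on_subset[OF admissible_ideal_on[OF assms(1)]] by blast
  then show False
    using assms(1) by (simp add: admissible_ideal_def proper_ideal_on_def)
qed

lemma Cauchy_net_imp_ideal_Cauchy:
  assumes "directed_set D le" and "admissible_ideal D le K" and "Cauchy_net D le x"
  shows "ideal_Cauchy D K x"
  unfolding ideal_Cauchy_def
proof
  fix U :: "('b \<times> 'b) set"
  assume "U \<in> entourages"
  then obtain d0 where d0: "d0 \<in> D"
      "\<And>d e. d \<in> D \<Longrightarrow> e \<in> D \<Longrightarrow> le d0 d \<Longrightarrow> le d0 e \<Longrightarrow> (x d, x e) \<in> U"
    using assms(3) unfolding Cauchy_net_def by blast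
  have "le d0 d0"
    using assms(1) d0(1) by (auto simp: directed_set_def reflp_on_def)
  then have "{n \<in> D. (x n, x d0) \<notin> U} \<subseteq> {n \<in> D. \<not> le d0 n}"
    using d0 by blast
  then have "{n \<in> D. (x n, x d0) \<notin> U} \<in> K"
    using ideal_on_subset[OF admissible_ideal_on[OF assms(2)]
        admissible_contains_tail_complement[OF assms(2) d0(1)]] by blast
  then show "\<exists>m\<in>D. {n \<in> D. (x n, x m) \<notin> U} \<in> K"
    using d0(1) by blast
qed

lemma Cauchy_net_imp_IK_Cauchy:
  assumes "directed_set D le" and "ideal_on D I" and "admissible_ideal D le K"
    and "Cauchy_net D le x"
  shows "IK_Cauchy D I K x"
proof -
  have "A \<inter> D = A" if "A \<in> K" for A
    using admissible_ideal_on[OF assms(3)] that by (auto simp: ideal_on_def)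
  then have "trace_on D K = K"
    unfolding trace_on_def by force
  then show ?thesis
    unfolding IK_Cauchy_def
    using carrier_in_dual[OF assms(2)] Cauchy_net_imp_ideal_Cauchy[OF assms(1,3,4)]
    by (intro bexI[of _ D]) simp_all
qed

text \<open>
  An index whose value misses a given neighborhood of the limit either lies in a set from \<open>K\<close>
  or lies outside the set of the dual filter on which the convergence takes place; both exceptional
  sets belong to \<open>I\<close>.
\<close>

lemma IK_converges_imp_ideal_converges:
  assumes "ideal_on D I" and "K \<subseteq> I" and "IK_converges D I K x l"
  shows "ideal_converges D I x l"
  unfolding ideal_converges_def
proof
  fix U assume U: "U \<in> neighborhoods l"
  obtain A where A: "A \<in> I" and conv: "ideal_converges (D - A) (trace_on (D - A) K) x l"
    using assms(3) by (auto simp: IK_converges_def dual_on_def)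
  obtain B where B: "B \<in> K"
      "{n \<in> D - A. x n \<in> U} = (D - A) - B \<inter> (D - A)"
    using conv U by (auto simp: ideal_converges_def dual_on_def trace_on_def)
  have "{n \<in> D. x n \<notin> U} \<subseteq> A \<union> B"
    using B(2) by blast
  moreover have "A \<union> B \<in> I"
    using A B(1) assms(1,2) by (blast intro: ideal_on_Un)
  ultimately have "{n \<in> D. x n \<notin> U} \<in> I"
    using assms(1) by (blast intro: ideal_on_subset)
  moreover have "{n \<in> D. x n \<in> U} = D - {n \<in> D. x n \<notin> U}"
    by blast
  ultimately show "{n \<in> D. x n \<in> U} \<in> dual_on D I"
    unfolding dual_on_def by blast
qed

lemma ideal_converges_imp_cluster_point:
  assumes "admissible_ideal D le I" and "ideal_converges D I x l"
    and "U \<in> neighborhoods l" and "d \<in> D"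
  shows "\<exists>e\<in>D. le d e \<and> x e \<in> U"
proof -
  obtain A where "A \<in> I" "{n \<in> D. x n \<in> U} = D - A"
    using assms(2,3) by (auto simp: ideal_converges_def dual_on_def)
  with admissible_set_misses_tail[OF assms(1) \<open>A \<in> I\<close> assms(4)] show ?thesis
    by blast
qed

text \<open>
  A cluster point is close to some late value of the net, and this value is close to all late
  values. Composing the two relations calls for an entourage whose square lies in the one that
  defines the given neighborhood.
\<close>

lemma Cauchy_net_converges_to_cluster_point:
  fixes x :: "'d \<Rightarrow> 'x::uniform_space"
  assumes "Cauchy_net D le x"
    and cluster: "\<And>U d. U \<in> neighborhoods l \<Longrightarrow> d \<in> D \<Longrightarrow> \<exists>e\<in>D. le d e \<and> x e \<in> U"
  shows "net_converges D le x l"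
  unfolding net_converges_def
proof
  fix U assume "U \<in> neighborhoods l"
  then have "eventually (\<lambda>(a, b). a = l \<longrightarrow> b \<in> U) uniformity"
    by (simp add: neighborhoods_def eventually_nhds_uniformity)
  from uniformity_transE[OF this] obtain E where E: "eventually E uniformity"
      "\<And>a b c. E (a, b) \<Longrightarrow> E (b, c) \<Longrightarrow> a = l \<longrightarrow> c \<in> U"
    by simp metis
  \<comment> \<open>The symmetric part of \<open>E\<close>: the Cauchy condition is stated for symmetric entourages.\<close>
  define V where "V = {(a, b). E (a, b) \<and> E (b, a)}"
  have ev: "eventually (\<lambda>p. p \<in> V) uniformity"
    using eventually_conj[OF E(1) uniformity_sym[OF E(1)]]
    by (rule eventually_mono) (auto simp: V_def)
  then have "V \<in> entourages"
    by (auto simp: entourages_def V_def sym_def)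
  then obtain d0 where d0: "d0 \<in> D"
      "\<And>d e. d \<in> D \<Longrightarrow> e \<in> D \<Longrightarrow> le d0 d \<Longrightarrow> le d0 e \<Longrightarrow> (x d, x e) \<in> V"
    using assms(1) unfolding Cauchy_net_def by blast
  have "{y. (l, y) \<in> V} \<in> neighborhoods l"
    using eventually_mono[OF ev, of "\<lambda>(a, b). a = l \<longrightarrow> (l, b) \<in> V"]
    by (auto simp: neighborhoods_def eventually_nhds_uniformity)
  then obtain e where e: "e \<in> D" "le d0 e" "(l, x e) \<in> V"
    using cluster[OF _ d0(1)] by blast
  have "x d \<in> U" if "d \<in> D" "le d0 d" for d
  proof -
    have "(x e, x d) \<in> V"
      using d0(2) e that by blast
    with e(3) show ?thesis
      using E(2)[of l "x e" "x d"] by (simp add: V_def)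
  qed
  with d0(1) show "\<exists>d0\<in>D. \<forall>d\<in>D. le d0 d \<longrightarrow> x d \<in> U"
    by blast
qed

theorem proposition4p8:
  fixes D :: "'d set" and le :: "'d \<Rightarrow> 'd \<Rightarrow> bool" and I K :: "'d set set"
  assumes "hausdorff_uniformity TYPE('x::uniform_space)"
    and "directed_set D le"
    and "admissible_ideal D le I"
    and "admissible_ideal D le K"
    and "K \<subseteq> I"
    and "\<forall>x :: 'd \<Rightarrow> 'x. IK_Cauchy D I K x \<longrightarrow> (\<exists>l. IK_converges D I K x l)"
  shows "\<forall>x :: 'd \<Rightarrow> 'x. Cauchy_net D le x \<longrightarrow> (\<exists>l. net_converges D le x l)"
proof (intro allI impI)
  fix x :: "'d \<Rightarrow> 'x"
  assume x: "Cauchy_net D le x"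
  note I = admissible_ideal_on[OF assms(3)]
  obtain l where "IK_converges D I K x l"
    using assms(6) Cauchy_net_imp_IK_Cauchy[OF assms(2) I assms(4) x] by blast
  then have "ideal_converges D I x l"
    by (rule IK_converges_imp_ideal_converges[OF I assms(5)])
  then have "net_converges D le x l"
    by (intro Cauchy_net_converges_to_cluster_point[OF x]
        ideal_converges_imp_cluster_point[OF assms(3)])
  then show "\<exists>l. net_converges D le x l" ..
qed

end
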